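(* Let $K=\mathbb{Q}(\sqrt{d})$ with $d\neq 1$ a squarefree integer, and let $\mathcal{O}$ be its ring of integers, assumed to be a unique factorization domain. Let $n\geq 1$ and let $C_{n+1}$ be the constant associated with the $\mathcal{O}$-PTE problem of size $n+1$. Let $p\in\mathbb{Z}$ be a prime which is either ramified in $\mathcal{O}$, with $p\mathcal{O}=\mathfrak{p}^2$, or split in $\mathcal{O}$, with $p\mathcal{O}=\mathfrak{p}_1\mathfrak{p}_2$; in the ramified case let $\mathfrak{P}=\mathfrak{p}$, and in the split case let $\mathfrak{P}$ be either $\mathfrak{p}_1$ or $\mathfrak{p}_2$. Let $s=\lfloor (n+1)/p\rfloor$ and let $\ell\geq 0$ be the largest integer such that $n+1\in\mathfrak{P}^\ell$. Then $C_{n+1}\in\mathfrak{P}^{\max(s-\ell,0)}$.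
   Context: An $\mathcal{O}$-PTE solution $X=_kY$ (with $k<m$) consists of two distinct collections (multisets) $X=\{x_1,\ldots,x_m\}$, $Y=\{y_1,\ldots,y_m\}$ of elements of $\mathcal{O}$ with $\sum_i x_i^j=\sum_i y_i^j$ for $j=1,\ldots,k$; it is ideal if $k=m-1$. For an ideal solution of size $m$, $\prod_{i=1}^m(z-x_i)-\prod_{i=1}^m(z-y_i)$ is a constant $C_{m,X,Y}\in\mathcal{O}$. The constant associated with the $\mathcal{O}$-PTE problem of size $m$ is $C_m:=\gcd\{C_{m,X,Y} : X=_{m-1}Y \text{ an ideal }\mathcal{O}\text{-PTE solution of size } m\}$ (well defined up to units since $\mathcal{O}$ is a UFD). *)

theory Defs
  imports
    "HOL-Algebra.Ring_Divisibility"
    "HOL-Algebra.Ideal_Product"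
    "HOL-Computational_Algebra.Computational_Algebra"
begin

text \<open>The field \<open>K = \<rat>(\<surd>d)\<close> as a subfield of the complex numbers, and its ring of integers
  as a ring record whose carrier is the set of algebraic integers in \<open>K\<close>.\<close>

definition quad_field :: "int \<Rightarrow> complex set" where
  "quad_field d = {of_rat a + of_rat b * csqrt (of_int d) | a b. True}"

definition quad_ring :: "int \<Rightarrow> complex ring" where
  "quad_ring d =
     \<lparr>carrier = {z \<in> quad_field d. algebraic_int z},
      monoid.mult = (*), one = 1, zero = 0, add = (+)\<rparr>"

text \<open>The collections may contain repeated elements, and ``distinct'' means different as
  multisets (not disjoint).\<close>

definition pte_solution ::
    "complex set \<Rightarrow> nat \<Rightarrow> nat \<Rightarrow> complex multiset \<Rightarrow> complex multiset \<Rightarrow> bool" where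
  "pte_solution A m k X Y \<longleftrightarrow>
     k < m \<and> size X = m \<and> size Y = m \<and> set_mset X \<subseteq> A \<and> set_mset Y \<subseteq> A \<and> X \<noteq> Y \<and>
     (\<forall>j\<in>{1..k}. (\<Sum>x\<in>#X. x ^ j) = (\<Sum>y\<in>#Y. y ^ j))"

definition ideal_pte_solution ::
    "complex set \<Rightarrow> nat \<Rightarrow> complex multiset \<Rightarrow> complex multiset \<Rightarrow> bool" where
  "ideal_pte_solution A m X Y \<longleftrightarrow> pte_solution A m (m - 1) X Y"

text \<open>By Newton's identities, the difference below is a constant polynomial for every ideal
  solution, so that the description determines a unique number in that case.\<close>

definition pte_const :: "complex multiset \<Rightarrow> complex multiset \<Rightarrow> complex" where
  "pte_const X Y = (THE C. (\<Prod>x\<in>#X. [:- x, 1:]) - (\<Prod>y\<in>#Y. [:- y, 1:]) = [:C:])"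

text \<open>The set version of \<^const>\<open>isgcd\<close>. A greatest common divisor is determined up to units
  only, whence a predicate. The set may be infinite, and a gcd of the empty set is \<open>0\<close>.\<close>

definition is_gcd_of_set :: "('a, 'b) ring_scheme \<Rightarrow> 'a set \<Rightarrow> 'a \<Rightarrow> bool" where
  "is_gcd_of_set R S c \<longleftrightarrow>
     c \<in> carrier R \<and> (\<forall>a\<in>S. c divides\<^bsub>R\<^esub> a) \<and>
     (\<forall>e\<in>carrier R. (\<forall>a\<in>S. e divides\<^bsub>R\<^esub> a) \<longrightarrow> e divides\<^bsub>R\<^esub> c)"

definition is_pte_constant :: "complex ring \<Rightarrow> nat \<Rightarrow> complex \<Rightarrow> bool" where
  "is_pte_constant R m C \<longleftrightarrow>
     is_gcd_of_set R {pte_const X Y | X Y. ideal_pte_solution (carrier R) m X Y} C"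

definition ramified_with :: "complex ring \<Rightarrow> nat \<Rightarrow> complex set \<Rightarrow> bool" where
  "ramified_with R p P \<longleftrightarrow> primeideal P R \<and> PIdl\<^bsub>R\<^esub> (of_nat p) = P \<cdot>\<^bsub>R\<^esub> P"

definition split_with :: "complex ring \<Rightarrow> nat \<Rightarrow> complex set \<Rightarrow> complex set \<Rightarrow> bool" where
  "split_with R p P1 P2 \<longleftrightarrow>
     primeideal P1 R \<and> primeideal P2 R \<and> P1 \<noteq> P2 \<and> PIdl\<^bsub>R\<^esub> (of_nat p) = P1 \<cdot>\<^bsub>R\<^esub> P2"

text \<open>Powers of ideals are powers in the multiplicative monoid of \<^const>\<open>ideals_set\<close>; in
  particular the zeroth power is the whole ring.\<close>

abbreviation ideal_power :: "('a, 'b) ring_scheme \<Rightarrow> 'a set \<Rightarrow> nat \<Rightarrow> 'a set" where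
  "ideal_power R P k \<equiv> P [^]\<^bsub>ideals_set R\<^esub> k"

end

theory Submission
  imports Defs
begin

text \<open>For a monic polynomial \<open>f\<close> of degree \<open>m\<close> and an ideal solution of size \<open>m\<close>, the difference
  of \<open>f\<close> and the polynomial with roots \<open>X\<close> has degree less than \<open>m\<close>, so its sums over \<open>X\<close> and
  \<open>Y\<close> agree; this gives \<open>m C = (\<Sum>y\<in>#Y. f(y)) - (\<Sum>x\<in>#X. f(x))\<close>. Take
  \<open>f(z) = z (z - 1) \<cdots> (z - m + 1)\<close>. As \<open>P\<close> has degree one, every \<open>x\<close> is congruent to an integer
  modulo \<open>P\<close>, so each block of \<open>p\<close> consecutive factors of \<open>f(x)\<close> contains an element of \<open>P\<close>, and
  \<open>m C \<in> P\<^sup>s\<close>. Unique factorization makes \<open>P\<close> principal, which allows to cancel \<open>m\<close> and to pass to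
  the greatest common divisor.\<close>

section \<open>Ideal solutions and monic polynomials\<close>

abbreviation root_poly :: "'a :: comm_ring_1 multiset \<Rightarrow> 'a poly" where
  "root_poly X \<equiv> \<Prod>x\<in>#X. [:- x, 1:]"

lemma degree_root_poly: "degree (root_poly X) = size (X :: 'a :: idom multiset)"
  and lead_coeff_root_poly: "coeff (root_poly X) (size X) = 1"
proof -
  have "degree (root_poly X) = size X \<and> coeff (root_poly X) (degree (root_poly X)) = 1"
  proof (induction X)
    case (add a X)
    then have IH: "degree (root_poly X) = size X" "coeff (root_poly X) (size X) = 1"
      by auto
    then have "root_poly X \<noteq> 0"
      by auto
    then have "degree (root_poly (add_mset a X)) = Suc (size X)"
      using IH by (simp add: degree_mult_eq del: mult_pCons_left)
    moreover have "lead_coeff (root_poly (add_mset a X)) = 1"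
      using IH by (simp add: lead_coeff_mult del: mult_pCons_left)
    ultimately show ?case
      by simp
  qed auto
  then show "degree (root_poly X) = size X" and "coeff (root_poly X) (size X) = 1"
    by auto
qed

lemma poly_root_poly: "poly (root_poly X) z = (\<Prod>x\<in>#X. z - x)"
  by (induction X) (auto simp: algebra_simps)

lemma poly_root_poly_eq_0: "x \<in># X \<Longrightarrow> poly (root_poly X) x = (0 :: 'a :: idom)"
  by (auto simp: poly_root_poly)

lemma degree_diff_monic_less:
  fixes p q :: "'a :: comm_ring_1 poly"
  assumes "degree p = m" "degree q = m" "coeff p m = 1" "coeff q m = 1" "m > 0"
  shows "degree (p - q) < m"
proof -
  have "degree (p - q) \<noteq> m"
  proof
    assume "degree (p - q) = m"
    moreover from this have "lead_coeff (p - q) = 0"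
      using assms by simp
    ultimately show False
      using \<open>m > 0\<close> \<open>degree (p - q) = m\<close> by (metis degree_0 leading_coeff_0_iff less_irrefl)
  qed
  moreover have "degree (p - q) \<le> m"
    using assms by (intro degree_diff_le) auto
  ultimately show ?thesis
    by simp
qed

lemma sum_mset_subtractf:
  fixes f g :: "'a \<Rightarrow> 'b :: ab_group_add"
  shows "(\<Sum>x\<in>#X. f x - g x) = (\<Sum>x\<in>#X. f x) - (\<Sum>x\<in>#X. g x)"
  by (induction X) auto

text \<open>Expanding \<open>p\<close> turns its sum over a collection into a linear combination of
  power sums. The zeroth power sum is the size, so equal sizes cover the exponent 0.\<close>

lemma sum_mset_poly_eq:
  fixes X Y :: "'a :: comm_ring_1 multiset"
  assumes "size X = size Y"
    and "\<And>j. 1 \<le> j \<Longrightarrow> j \<le> k \<Longrightarrow> (\<Sum>x\<in>#X. x ^ j) = (\<Sum>y\<in>#Y. y ^ j)"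
    and "degree p \<le> k"
  shows "(\<Sum>x\<in>#X. poly p x) = (\<Sum>y\<in>#Y. poly p y)"
proof -
  have expand: "(\<Sum>x\<in>#Z. poly p x) = (\<Sum>i\<le>degree p. coeff p i * (\<Sum>x\<in>#Z. x ^ i))" for Z
    by (induction Z) (auto simp: poly_altdef sum.distrib algebra_simps)
  have "(\<Sum>x\<in>#X. x ^ i) = (\<Sum>y\<in>#Y. y ^ i)" if "i \<le> k" for i
    using assms(1,2) that by (cases "i = 0") auto
  then show ?thesis
    unfolding expand using assms(3) by (intro sum.cong) auto
qed

section \<open>Divided differences via synthetic division\<close>

lemma synthetic_div_diff:
  fixes p q :: "'a :: comm_ring_1 poly"
  shows "synthetic_div (p - q) c = synthetic_div p c - synthetic_div q c"
proof -
  \<comment> \<open>\<open>synthetic_div p c\<close> is the quotient (p(z) - p(c)) / (z - c). It is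
    the only \<open>q\<close> with p + c q = z q + p(c), so verifying this equation identifies it,
    here and in the next two lemmas.\<close>
  have "(p - q) + smult c (synthetic_div p c - synthetic_div q c)
      = (p + smult c (synthetic_div p c)) - (q + smult c (synthetic_div q c))"
    by (simp add: smult_diff_right)
  also have "\<dots> = pCons (poly (p - q) c) (synthetic_div p c - synthetic_div q c)"
    by (simp add: synthetic_div_correct)
  finally show ?thesis
    using synthetic_div_unique by metis
qed

text \<open>At a root \<open>c\<close> of \<open>p\<close> the division by z - c is exact, so a
  further factor \<open>q\<close> passes through the quotient.\<close>

lemma synthetic_div_mult_root:
  fixes p q :: "'a :: comm_ring_1 poly"
  assumes "poly p c = 0"
  shows "synthetic_div (q * p) c = q * synthetic_div p c"
proof -
  have "q * p + smult c (q * synthetic_div p c) = q * (p + smult c (synthetic_div p c))"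
    by (simp add: algebra_simps)
  also have "\<dots> = pCons (poly (q * p) c) (q * synthetic_div p c)"
    using assms by (simp add: synthetic_div_correct)
  finally show ?thesis
    using synthetic_div_unique by metis
qed

lemma synthetic_div_linear_mult:
  fixes p :: "'a :: comm_ring_1 poly"
  shows "synthetic_div ([:- c, 1:] * p) c = p"
proof -
  have "[:- c, 1:] * p + smult c p = pCons 0 p"
    by simp
  then show ?thesis
    using synthetic_div_unique by metis
qed

lemma coeff_synthetic_div_top:
  fixes p :: "'a :: comm_ring_1 poly"
  assumes "degree p = Suc k"
  shows "coeff (synthetic_div p c) k = coeff p (Suc k)"
proof -
  have "coeff (synthetic_div p c) (Suc k) = 0"
    using assms by (intro coeff_eq_0) (simp add: degree_synthetic_div)
  then show ?thesis
    using arg_cong[OF synthetic_div_correct[of p c], of "\<lambda>q. coeff q (Suc k)"] by simp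
qed

text \<open>This is the logarithmic derivative f' = sum of f / (z - x) over the roots. The induction
  is the product rule: the old roots keep the factor z - a, and the new root contributes
  \<open>root_poly X\<close>.\<close>

lemma pderiv_root_poly:
  "pderiv (root_poly X) = (\<Sum>x\<in>#X. synthetic_div (root_poly X) x)"
  for X :: "'a :: idom multiset"
proof (induction X)
  case (add a X)
  have "(\<Sum>x\<in>#X. synthetic_div (root_poly (add_mset a X)) x)
      = (\<Sum>x\<in>#X. [:- a, 1:] * synthetic_div (root_poly X) x)"
    using synthetic_div_mult_root[OF poly_root_poly_eq_0]
    by (intro arg_cong[where f = sum_mset] image_mset_cong)
       (simp del: mult_pCons_left)
  also have "\<dots> = [:- a, 1:] * pderiv (root_poly X)"
    by (simp only: add.IH sum_mset_distrib_left)
  finally have "(\<Sum>x\<in>#add_mset a X. synthetic_div (root_poly (add_mset a X)) x)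
      = root_poly X + [:- a, 1:] * pderiv (root_poly X)"
    using synthetic_div_linear_mult[of a "root_poly X"] by (simp del: mult_pCons_left)
  also have "\<dots> = pderiv (root_poly (add_mset a X))"
    by (simp add: pderiv_mult pderiv_pCons del: mult_pCons_left)
  finally show ?case ..
qed auto

text \<open>Each coefficient of \<open>synthetic_div p x\<close> is a polynomial in \<open>x\<close>
  of degree below that of \<open>p\<close>. Hence power sums up to \<open>k\<close> control
  polynomials of degree up to \<open>Suc k\<close>.\<close>

lemma sum_mset_synthetic_div_eq:
  fixes X Y :: "'a :: comm_ring_1 multiset"
  assumes "size X = size Y"
    and "\<And>j. 1 \<le> j \<Longrightarrow> j \<le> k \<Longrightarrow> (\<Sum>x\<in>#X. x ^ j) = (\<Sum>y\<in>#Y. y ^ j)"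
    and "degree p \<le> Suc k"
  shows "(\<Sum>x\<in>#X. synthetic_div p x) = (\<Sum>y\<in>#Y. synthetic_div p y)"
  using assms(3)
proof (induction p)
  case (pCons a p)
  have split: "(\<Sum>x\<in>#Z. synthetic_div (pCons a p) x)
      = pCons (\<Sum>x\<in>#Z. poly p x) (\<Sum>x\<in>#Z. synthetic_div p x)" for Z
    by (induction Z) auto
  have "degree p \<le> k"
    using pCons.prems by (cases "p = 0") auto
  then show ?case
    unfolding split using sum_mset_poly_eq[OF assms(1,2)] pCons.IH by simp
next
  case 0
  have "(\<Sum>x\<in>#Z. synthetic_div 0 x) = (0 :: 'a poly)" for Z
    by (induction Z) auto
  then show ?case
    by simp
qed

text \<open>This replaces Newton's identities: for \<open>D\<close> the difference of the two polynomials, the sums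
  over \<open>X\<close> and \<open>Y\<close> of the divided differences of the second one agree, so that
  \<open>D' = (\<Sum>x\<in>#X. (D(z) - D(x)) / (z - x))\<close>. If \<open>D\<close> had degree \<open>k > 0\<close>, comparing
  leading coefficients would give \<open>k = size X\<close>, which exceeds the degree of \<open>D\<close>.\<close>

lemma root_poly_diff_constant:
  fixes X Y :: "'a :: field_char_0 multiset"
  assumes "size X = m" "size Y = m" "m > 0"
    and "\<And>j. 1 \<le> j \<Longrightarrow> j \<le> m - 1 \<Longrightarrow> (\<Sum>x\<in>#X. x ^ j) = (\<Sum>y\<in>#Y. y ^ j)"
  obtains c where "root_poly X - root_poly Y = [:c:]"
proof -
  define D where "D = root_poly X - root_poly Y"
  have less: "degree D < m"
    unfolding D_def using degree_diff_monic_less degree_root_poly lead_coeff_root_poly assms(1-3)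
    by metis
  have "(\<Sum>x\<in>#X. synthetic_div (root_poly Y) x) = (\<Sum>y\<in>#Y. synthetic_div (root_poly Y) y)"
    by (rule sum_mset_synthetic_div_eq[of _ _ "m - 1"])
       (use assms in \<open>auto simp: degree_root_poly\<close>)
  then have deriv: "pderiv D = (\<Sum>x\<in>#X. synthetic_div D x)"
    by (simp add: D_def pderiv_diff pderiv_root_poly synthetic_div_diff
          sum_mset_subtractf)
  have "degree D = 0"
  proof (rule ccontr)
    assume "degree D \<noteq> 0"
    then obtain k where k: "degree D = Suc k"
      by (cases "degree D") auto
    have "coeff (\<Sum>x\<in>#Z. synthetic_div D x) k = of_nat (size Z) * lead_coeff D" for Z
      by (induction Z) (auto simp: coeff_synthetic_div_top k algebra_simps)
    then have "of_nat (Suc k) * lead_coeff D = of_nat m * lead_coeff D"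
      using arg_cong[OF deriv, of "\<lambda>q. coeff q k"] assms(1) by (simp add: coeff_pderiv k)
    moreover have "lead_coeff D \<noteq> 0"
      using k by (metis degree_0 leading_coeff_0_iff nat.distinct(1))
    ultimately have "Suc k = m"
      by (metis mult_cancel_right of_nat_eq_iff)
    then show False
      using less k by simp
  qed
  then show thesis
    using that degree_eq_zeroE unfolding D_def by metis
qed

section \<open>The constant of an ideal solution\<close>

lemma pte_const_eqI: "root_poly X - root_poly Y = [:c:] \<Longrightarrow> pte_const X Y = c"
  unfolding pte_const_def by (rule the_equality) auto

lemma ideal_pte_solution_root_poly_diff:
  assumes "ideal_pte_solution A m X Y"
  shows "root_poly X - root_poly Y = [:pte_const X Y:]"
proof -
  have "size X = m" "size Y = m" "m > 0"
    "\<And>j. 1 \<le> j \<Longrightarrow> j \<le> m - 1 \<Longrightarrow> (\<Sum>x\<in>#X. x ^ j) = (\<Sum>y\<in>#Y. y ^ j)"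
    using assms unfolding ideal_pte_solution_def pte_solution_def by auto
  from root_poly_diff_constant[OF this] show ?thesis
    using pte_const_eqI by metis
qed

text \<open>Evaluation at 0. This form shows that the constant lies in the ring that contains the
  collections.\<close>

lemma pte_const_eq_prod_diff:
  assumes "ideal_pte_solution A m X Y"
  shows "pte_const X Y = (\<Prod>x\<in>#X. - x) - (\<Prod>y\<in>#Y. - y)"
  using arg_cong[OF ideal_pte_solution_root_poly_diff[OF assms], of "\<lambda>p. poly p 0"]
  by (simp add: poly_root_poly)

lemma size_mult_pte_const:
  fixes f :: "complex poly"
  assumes "ideal_pte_solution A m X Y" "degree f = m" "coeff f m = 1"
  shows "of_nat m * pte_const X Y = (\<Sum>y\<in>#Y. poly f y) - (\<Sum>x\<in>#X. poly f x)"
proof -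
  have sol: "size X = m" "size Y = m" "m > 0"
    "\<And>j. 1 \<le> j \<Longrightarrow> j \<le> m - 1 \<Longrightarrow> (\<Sum>x\<in>#X. x ^ j) = (\<Sum>y\<in>#Y. y ^ j)"
    using assms(1) unfolding ideal_pte_solution_def pte_solution_def by auto
  define h where "h = f - root_poly X"
  have "degree h < m"
    unfolding h_def using degree_diff_monic_less degree_root_poly lead_coeff_root_poly sol assms
    by metis
  then have sums: "(\<Sum>x\<in>#X. poly h x) = (\<Sum>y\<in>#Y. poly h y)"
    by (intro sum_mset_poly_eq[of _ _ "m - 1"]) (use sol in auto)
  \<comment> \<open>\<open>root_poly X\<close> vanishes on \<open>X\<close> and equals the constant
    on \<open>Y\<close>, where \<open>root_poly Y\<close> vanishes. So \<open>h\<close> agrees with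
    \<open>f\<close> on \<open>X\<close> and is shifted by the constant on \<open>Y\<close>.\<close>
  have X: "poly h x = poly f x" if "x \<in># X" for x
    using poly_root_poly_eq_0[OF that] by (simp add: h_def)
  have Y: "poly h y = poly f y - pte_const X Y" if "y \<in># Y" for y
    using poly_root_poly_eq_0[OF that]
      arg_cong[OF ideal_pte_solution_root_poly_diff[OF assms(1)], of "\<lambda>p. poly p y"]
    by (simp add: h_def)
  have "(\<Sum>x\<in>#X. poly f x) = (\<Sum>x\<in>#X. poly h x)"
    by (intro arg_cong[where f = sum_mset] image_mset_cong) (simp add: X)
  also have "\<dots> = (\<Sum>y\<in>#Y. poly f y - pte_const X Y)"
    unfolding sums by (intro arg_cong[where f = sum_mset] image_mset_cong) (simp add: Y)
  also have "\<dots> = (\<Sum>y\<in>#Y. poly f y) - of_nat (size Y) * pte_const X Y"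
    by (simp add: sum_mset_subtractf)
  finally show ?thesis
    using sol by simp
qed

section \<open>Prime ideals with principal product\<close>

text \<open>Some irreducible factor of \<open>a\<close> lies in \<open>P\<close>, as
  \<open>P\<close> is prime and does not contain the empty product. In a factorial domain it is a
  prime element. The factorization lives in \<open>mult_of R\<close> and gives \<open>a\<close> only
  up to an associate.\<close>

lemma (in factorial_domain) primeideal_obtain_prime_factor:
  assumes "primeideal P R" "a \<in> P" "a \<noteq> \<zero>"
  obtains q where "q \<in> P" "ring_prime q" "q divides a"
proof -
  interpret P: primeideal P R by fact
  have a: "a \<in> carrier (mult_of R)"
    using assms P.Icarr by auto
  obtain fs where fs: "set fs \<subseteq> carrier (mult_of R)" "wfactors (mult_of R) fs a"
    using wfactors_exist[OF a] by auto
  have prod: "foldr (\<otimes>) fs \<one> \<sim>\<^bsub>mult_of R\<^esub> a"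
    using fs(2) by (auto simp: wfactors_def)
  have some: "\<exists>f\<in>set gs. f \<in> P" if "foldr (\<otimes>) gs \<one> \<in> P" "set gs \<subseteq> carrier R" for gs
    using that
  proof (induction gs)
    case Nil
    then show ?case
      using P.I_notcarr P.one_imp_carrier by auto
  next
    case (Cons g gs)
    have "foldr (\<otimes>) gs \<one> \<in> carrier R"
      using Cons.prems(2) by (induction gs) auto
    then have "g \<in> P \<or> foldr (\<otimes>) gs \<one> \<in> P"
      using Cons.prems P.I_prime by auto
    then show ?case
      using Cons by auto
  qed
  obtain b where "b \<in> carrier R" "foldr (\<otimes>) fs \<one> = a \<otimes> b"
    using prod unfolding associated_def factor_def by auto
  then have "foldr (\<otimes>) fs \<one> \<in> P"
    using assms P.I_r_closed by auto
  then obtain f where f: "f \<in> set fs" "f \<in> P"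
    using some fs(1) by auto
  then have f_carr: "f \<in> carrier (mult_of R)"
    using fs(1) by blast
  moreover have "Divisibility.irreducible (mult_of R) f"
    using fs(2) f by (auto simp: wfactors_def)
  ultimately have "Divisibility.prime (mult_of R) f"
    using irreducible_prime by blast
  then have "ring_prime f"
    using f_carr by (intro ring_primeI') simp_all
  moreover have "f divides a"
    using mult_of.wfactors_dividesI[OF fs(2,1) a f(1)] by (rule divides_mult_imp_divides)
  ultimately show thesis
    using that f by auto
qed

text \<open>Let \<open>q \<in> P\<close> be a prime factor of \<open>a\<close>. As \<open>(q)\<close> is a prime ideal containing \<open>P Q\<close>,
  it contains \<open>P\<close>, and then \<open>P = (q)\<close>, or it contains \<open>Q\<close>. If the same argument for \<open>Q\<close> gives
  \<open>Q = (q')\<close>, then cancelling \<open>q'\<close> in \<open>P Q = (a)\<close> shows that \<open>P\<close> is principal; otherwise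
  \<open>P \<subseteq> (q') \<subseteq> Q \<subseteq> (q) \<subseteq> P\<close>.\<close>

lemma (in factorial_domain) primeideal_factor_principal:
  assumes "primeideal P R" "primeideal Q R" "P \<cdot> Q = PIdl a" "a \<in> carrier R" "a \<noteq> \<zero>"
  obtains b where "b \<in> carrier R" "P = PIdl b"
proof -
  interpret P: primeideal P R by fact
  interpret Q: primeideal Q R by fact
  have PQ_sub: "P \<cdot> Q \<subseteq> P \<inter> Q"
    using ideal_prod_inter P.is_ideal Q.is_ideal by blast
  have a_in: "a \<in> P" "a \<in> Q"
    using PQ_sub cgenideal_self[OF assms(4)] assms(3) by auto
  have prime_gen: "\<exists>q\<in>carrier R. PIdl q \<subseteq> I \<and> (P \<subseteq> PIdl q \<or> Q \<subseteq> PIdl q) \<and> a \<in> PIdl q \<and> q \<noteq> \<zero>"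
    if I: "primeideal I R" "a \<in> I" for I
  proof -
    interpret I: primeideal I R by fact
    obtain q where q: "q \<in> I" "ring_prime q" "q divides a"
      using primeideal_obtain_prime_factor[OF I assms(5)] .
    have q_carr: "q \<in> carrier R"
      using q I.Icarr by auto
    have a_q: "a \<in> PIdl q"
      using q(3) m_comm[OF q_carr] unfolding factor_def cgenideal_def by auto
    interpret q: primeideal "PIdl q" R
      using primeideal_iff_prime[of q] q q_carr unfolding ring_prime_def by auto
    have "P \<cdot> Q \<subseteq> PIdl q"
      unfolding assms(3) using cgenideal_minimal[OF q.is_ideal a_q] .
    then show ?thesis
      using primeideal_divides_ideal_prod[OF q.primeideal P.is_ideal Q.is_ideal]
        cgenideal_minimal[OF I.is_ideal q(1)] q(2) q_carr a_q
      unfolding ring_prime_def by auto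
  qed
  obtain q where q: "q \<in> carrier R" "PIdl q \<subseteq> P" "P \<subseteq> PIdl q \<or> Q \<subseteq> PIdl q"
    using prime_gen[OF P.primeideal a_in(1)] by auto
  obtain q' where q': "q' \<in> carrier R" "PIdl q' \<subseteq> Q" "P \<subseteq> PIdl q' \<or> Q \<subseteq> PIdl q'"
    "a \<in> PIdl q'" "q' \<noteq> \<zero>"
    using prime_gen[OF Q.primeideal a_in(2)] by auto
  show thesis
  proof (cases "P \<subseteq> PIdl q \<or> P \<subseteq> PIdl q'")
    case True
    then have "P = PIdl q"
      using q q' by blast
    then show ?thesis
      using that q by auto
  next
    case False
    then have Q: "Q = PIdl q'"
      using q' by auto
    \<comment> \<open>The cofactor \<open>b\<close> of \<open>q'\<close> in \<open>a\<close> is the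
      generator of \<open>P\<close>: as Q = (q'), the product P Q consists of the multiples of
      \<open>q'\<close> by elements of \<open>P\<close>.\<close>
    obtain b where b: "b \<in> carrier R" "a = b \<otimes> q'"
      using q'(4) unfolding cgenideal_def by auto
    have "b \<otimes> q' \<in> PIdl a"
      using cgenideal_self[OF assms(4)] b(2) by simp
    have PIdl_a: "PIdl a = {r \<otimes> a | r. r \<in> carrier R}"
      by (simp add: cgenideal_def)
    have "P \<subseteq> PIdl b"
    proof
      fix x assume x: "x \<in> P"
      then have x_carr: "x \<in> carrier R"
        using P.Icarr by auto
      have "x \<otimes> q' \<in> P \<cdot> Q"
        using x Q cgenideal_self[OF q'(1)] by (auto intro: ideal_prod.prod)
      then obtain r where r: "r \<in> carrier R" "x \<otimes> q' = r \<otimes> a"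
        unfolding assms(3) PIdl_a by auto
      then have "x \<otimes> q' = (r \<otimes> b) \<otimes> q'"
        using b q' by (simp add: m_assoc)
      then have "x = r \<otimes> b"
        using m_rcancel[OF q'(5) q'(1)] x_carr r b by auto
      then show "x \<in> PIdl b"
        using r unfolding cgenideal_def by auto
    qed
    moreover have "b \<in> P"
    proof -
      have mult_q': "\<exists>x\<in>P. z = x \<otimes> q'" if "z \<in> P \<cdot> Q" for z
        using that
      proof induction
        case (prod i j)
        then obtain r where r: "r \<in> carrier R" "j = r \<otimes> q'"
          unfolding Q cgenideal_def by auto
        then have "i \<otimes> j = (i \<otimes> r) \<otimes> q'"
          using prod P.Icarr q' by (simp add: m_assoc)
        moreover have "i \<otimes> r \<in> P"
          using prod r P.I_r_closed by auto
        ultimately show ?case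
          by auto
      next
        case (sum z1 z2)
        then obtain x1 x2 where "x1 \<in> P" "z1 = x1 \<otimes> q'" "x2 \<in> P" "z2 = x2 \<otimes> q'"
          by auto
        then show ?case
          using q'(1) P.Icarr by (intro bexI[of _ "x1 \<oplus> x2"]) (auto simp: l_distr)
      qed
      obtain x where "x \<in> P" "a = x \<otimes> q'"
        using mult_q' assms(3) cgenideal_self[OF assms(4)] by auto
      then show ?thesis
        using b m_rcancel[OF q'(5) q'(1)] P.Icarr by metis
    qed
    ultimately have "P = PIdl b"
      using cgenideal_minimal[OF P.is_ideal] by auto
    then show ?thesis
      using that b by auto
  qed
qed

lemma (in cring) ideal_power_PIdl:
  assumes "a \<in> carrier R"
  shows "ideal_power R (PIdl a) k = PIdl (a [^] k)"
proof (induction k)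
  case 0
  then show ?case
    using cgenideal_eq_genideal[OF one_closed] genideal_one by (simp add: ideals_set_def nat_pow_def)
next
  case (Suc k)
  have "ideal_power R (PIdl a) (Suc k) = ideal_power R (PIdl a) k \<cdot> (PIdl a)"
    by (simp add: ideals_set_def nat_pow_def)
  also have "\<dots> = Idl (PIdl (a [^] k \<otimes> a))"
    using assms Suc by (simp add: ideal_prod_eq_genideal cgenideal_ideal cgenideal_prod)
  \<comment> \<open>The elementwise products of two principal ideals already form an ideal, so
    generating adds nothing.\<close>
  also have "\<dots> = PIdl (a [^] k \<otimes> a)"
  proof
    have I: "ideal (PIdl (a [^] k \<otimes> a)) R"
      using assms by (simp add: cgenideal_ideal)
    show "Idl (PIdl (a [^] k \<otimes> a)) \<subseteq> PIdl (a [^] k \<otimes> a)"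
      by (rule genideal_minimal[OF I subset_refl])
    show "PIdl (a [^] k \<otimes> a) \<subseteq> Idl (PIdl (a [^] k \<otimes> a))"
      using ideal.Icarr[OF I] by (intro genideal_self) blast
  qed
  finally show ?case
    by simp
qed

text \<open>The corresponding fact about prime powers concerns the monoid \<open>mult_of R\<close>
  of nonzero elements, so b = 0 is treated apart, while \<open>a\<close> is nonzero because
  \<open>q\<close> does not divide it.\<close>

lemma (in domain) ring_prime_pow_divides_mult:
  assumes "q \<in> carrier R" "ring_prime q" "a \<in> carrier R" "b \<in> carrier R"
    and "\<not> q divides a" "(q [^] (k :: nat)) divides (a \<otimes> b)"
  shows "(q [^] k) divides b"
proof (cases "b = \<zero>")
  case True
  then show ?thesis
    using assms by (simp add: divides_zero)
next
  case False
  have "a \<noteq> \<zero>"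
    using assms(5) divides_zero[OF assms(1)] by blast
  have q: "q \<noteq> \<zero>" "Divisibility.prime (mult_of R) q"
    using ring_primeE(1,2)[OF assms(1,2)] .
  have "(q [^] k) divides\<^bsub>mult_of R\<^esub> (a \<otimes> b)"
  proof (rule divides_imp_divides_mult[OF _ _ assms(6)])
    show "q [^] k \<in> carrier R"
      using assms(1) by (rule nat_pow_closed)
    show "a \<otimes> b \<in> carrier R - {\<zero>}"
      using integral_iff[OF assms(3,4)] m_closed[OF assms(3,4)] False \<open>a \<noteq> \<zero>\<close> by blast
  qed
  moreover have "\<not> q divides\<^bsub>mult_of R\<^esub> a"
    using assms(5) by (rule contrapos_nn) (rule divides_mult_imp_divides)
  ultimately have "(q [^] k) divides\<^bsub>mult_of R\<^esub> b"
    using mult_of.prime_pow_divides_iff[of q a b k] assms(1,3,4) False \<open>a \<noteq> \<zero>\<close> q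
    unfolding nat_pow_mult_of carrier_mult_of by blast
  then show ?thesis
    by (rule divides_mult_imp_divides)
qed

text \<open>If \<open>b\<close> were in P Q, then b = y b with \<open>y\<close> in \<open>Q\<close>,
  and cancelling \<open>b\<close> would put 1 into the proper ideal \<open>Q\<close>. With a = p
  this supplies an element of \<open>P\<close> outside (p), which an inert prime would not
  have.\<close>

lemma (in domain) primeideal_factor_not_subset:
  assumes "ideal P R" "primeideal Q R" "P \<cdot> Q = PIdl a" "a \<in> carrier R" "a \<noteq> \<zero>"
    and "P = PIdl b" "b \<in> carrier R"
  shows "\<not> P \<subseteq> PIdl a"
proof
  interpret Q: primeideal Q R by fact
  have b: "b \<in> P"
    using assms cgenideal_self by auto
  assume "P \<subseteq> PIdl a"
  then have "b \<in> P \<cdot> Q"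
    using b assms by auto
  moreover have "\<exists>y\<in>Q. z = y \<otimes> b" if "z \<in> P \<cdot> Q" for z
    using that
  proof induction
    case (prod i j)
    then obtain r where r: "r \<in> carrier R" "i = r \<otimes> b"
      using assms unfolding cgenideal_def by auto
    then have "i \<otimes> j = (r \<otimes> j) \<otimes> b"
      using prod Q.Icarr assms by (simp add: m_ac)
    then show ?case
      using prod r Q.I_l_closed by auto
  next
    case (sum z1 z2)
    then obtain y1 y2 where "y1 \<in> Q" "z1 = y1 \<otimes> b" "y2 \<in> Q" "z2 = y2 \<otimes> b"
      by auto
    then show ?case
      using assms Q.Icarr by (intro bexI[of _ "y1 \<oplus> y2"]) (auto simp: l_distr)
  qed
  ultimately obtain y where y: "y \<in> Q" "b = y \<otimes> b"
    by auto
  have "b \<noteq> \<zero>"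
  proof
    assume "b = \<zero>"
    then have "PIdl b \<subseteq> {\<zero>}"
      by (auto simp: cgenideal_def)
    then show False
      using assms ideal_prod_inter[OF assms(1) Q.is_ideal] cgenideal_self[OF assms(4)] by auto
  qed
  then have "y = \<one>"
    using y m_rcancel[of b y \<one>] assms Q.Icarr by auto
  then show False
    using y Q.one_imp_carrier Q.I_notcarr by auto
qed

section \<open>Residues modulo a prime of degree one\<close>

text \<open>The field has dimension at most two over the rationals, so 1, y, x are dependent.
  Clearing denominators and dividing by the gcd of the coefficients makes them jointly coprime, so
  \<open>p\<close> cannot divide all three.\<close>

lemma quad_field_integer_relation:
  assumes "x \<in> quad_field d" "y \<in> quad_field d" "p > 1"
  obtains a b c :: int where "of_int a + of_int b * y + of_int c * x = 0"
    and "\<not> (p dvd a \<and> p dvd b \<and> p dvd c)"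
proof -
  obtain x1 x2 where x: "x = of_rat x1 + of_rat x2 * csqrt (of_int d)"
    using assms unfolding quad_field_def by auto
  obtain y1 y2 where y: "y = of_rat y1 + of_rat y2 * csqrt (of_int d)"
    using assms unfolding quad_field_def by auto
  have "\<exists>a b c :: rat. of_rat a + of_rat b * y + of_rat c * x = 0 \<and> \<not> (a = 0 \<and> b = 0 \<and> c = 0)"
  proof (cases "x2 = 0 \<and> y2 = 0")
    case False
    \<comment> \<open>In y2 x - x2 y the square root cancels, leaving the rational x1 y2 - y1
      x2.\<close>
    then show ?thesis
      by (intro exI[of _ "y1 * x2 - x1 * y2"] exI[of _ "- x2"] exI[of _ y2])
         (auto simp: x y of_rat_diff of_rat_mult of_rat_minus algebra_simps)
  next
    case True
    then have "of_rat (- x1) + of_rat 0 * y + of_rat 1 * x = 0 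
        \<and> \<not> (- x1 = 0 \<and> 0 = (0 :: rat) \<and> 1 = (0 :: rat))"
      by (simp add: x of_rat_minus)
    then show ?thesis
      by blast
  qed
  then obtain a b c :: rat
    where abc: "of_rat a + of_rat b * y + of_rat c * x = 0" "\<not> (a = 0 \<and> b = 0 \<and> c = 0)"
    by blast
  have quotient: "\<exists>i j. r = of_int i / of_int j \<and> j \<noteq> 0" for r :: rat
    by (cases r) (auto simp: Fract_of_int_quotient)
  obtain a1 a2 where a: "a = of_int a1 / of_int a2" "a2 \<noteq> 0"
    using quotient by blast
  obtain b1 b2 where b: "b = of_int b1 / of_int b2" "b2 \<noteq> 0"
    using quotient by blast
  obtain c1 c2 where c: "c = of_int c1 / of_int c2" "c2 \<noteq> 0"
    using quotient by blast
  define A B C where "A = a1 * b2 * c2" and "B = b1 * a2 * c2" and "C = c1 * a2 * b2"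
  have rel: "of_int A + of_int B * y + of_int C * x = 0"
  proof -
    have "of_int A + of_int B * y + of_int C * x
        = of_int (a2 * b2 * c2) * (of_rat a + of_rat b * y + of_rat c * x)"
      using a(2) b(2) c(2)
      by (simp add: A_def B_def C_def a(1) b(1) c(1) of_rat_divide field_simps)
    then show ?thesis
      using abc by simp
  qed
  have nz: "\<not> (A = 0 \<and> B = 0 \<and> C = 0)"
    using abc a b c by (auto simp: A_def B_def C_def)
  define g where "g = gcd A (gcd B C)"
  have g: "g \<noteq> 0" "g dvd A" "g dvd B" "g dvd C"
    using nz by (auto simp: g_def intro: dvd_trans[OF gcd_dvd2])
  obtain A' B' C' where A': "A = g * A'" "B = g * B'" "C = g * C'"
    using g by (auto elim!: dvdE)
  have "of_int g * (of_int A' + of_int B' * y + of_int C' * x) = 0"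
    using rel by (simp add: A' algebra_simps)
  then have "of_int A' + of_int B' * y + of_int C' * x = 0"
    using g by simp
  moreover have "\<not> (p dvd A' \<and> p dvd B' \<and> p dvd C')"
  proof
    assume "p dvd A' \<and> p dvd B' \<and> p dvd C'"
    then have "g * p dvd A" "g * p dvd B" "g * p dvd C"
      unfolding A' by auto
    then have "g * p dvd g"
      unfolding g_def by auto
    then show False
      using g assms(3) by auto
  qed
  ultimately show thesis
    using that by blast
qed

text \<open>The carrier stays abstract while the operations are those of the complex numbers, so
  that ring terms simplify to plain arithmetic and the results on complex polynomials apply.\<close>

locale complex_factorial_domain = factorial_domain R for R :: "complex ring" (structure) +
  assumes mult_eq [simp]: "x \<otimes> y = x * y" and add_eq [simp]: "x \<oplus> y = x + y"
    and one_eq [simp]: "\<one> = 1" and zero_eq [simp]: "\<zero> = 0"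
begin

lemma a_inv_eq [simp]:
  assumes "x \<in> carrier R"
  shows "\<ominus> x = - x"
  using r_neg[OF assms] by (simp add: add_eq_0_iff)

lemma nat_pow_eq [simp]: "x [^] (k :: nat) = x ^ k"
  by (induction k) auto

lemma add_closed': "x \<in> carrier R \<Longrightarrow> y \<in> carrier R \<Longrightarrow> x + y \<in> carrier R"
  using add.m_closed[of x y] by simp

lemma mult_closed': "x \<in> carrier R \<Longrightarrow> y \<in> carrier R \<Longrightarrow> x * y \<in> carrier R"
  using m_closed[of x y] by simp

lemma uminus_closed': "x \<in> carrier R \<Longrightarrow> - x \<in> carrier R"
  using a_inv_closed[of x] by simp

lemma diff_closed': "x \<in> carrier R \<Longrightarrow> y \<in> carrier R \<Longrightarrow> x - y \<in> carrier R"
  using add_closed'[of x "- y"] uminus_closed' by simp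

lemma of_nat_closed': "of_nat k \<in> carrier R"
  using zero_closed one_closed by (induction k) (auto simp: add_closed')

lemma of_int_closed': "of_int k \<in> carrier R"
  using of_nat_closed' uminus_closed' by (cases k) (auto simp del: of_nat_Suc)

lemma prod_mset_closed':
  "(\<And>x. x \<in># X \<Longrightarrow> f x \<in> carrier R) \<Longrightarrow> (\<Prod>x\<in>#X. f x) \<in> carrier R"
  using one_closed by (induction X) (auto simp: mult_closed')

lemma mem_PIdl_iff: "x \<in> PIdl q \<longleftrightarrow> (\<exists>r\<in>carrier R. x = r * q)"
  by (auto simp: cgenideal_def)

lemma mem_PIdl_iff_divides: "x \<in> PIdl q \<longleftrightarrow> q divides x"
  by (auto simp: mem_PIdl_iff factor_def mult.commute)

lemma ideal_closed:
  assumes "ideal I R"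
  shows "x \<in> I \<Longrightarrow> y \<in> I \<Longrightarrow> x + y \<in> I" and "x \<in> I \<Longrightarrow> y \<in> I \<Longrightarrow> x - y \<in> I"
    and "x \<in> I \<Longrightarrow> - x \<in> I"
    and "x \<in> I \<Longrightarrow> r \<in> carrier R \<Longrightarrow> r * x \<in> I" and "0 \<in> I"
proof -
  interpret ideal I R by fact
  show add: "x + y \<in> I" if "x \<in> I" "y \<in> I" for x y
    using a_closed[OF that] by simp
  show neg: "- x \<in> I" if "x \<in> I" for x
    using a_inv_closed[OF that] Icarr[OF that] by simp
  show "x - y \<in> I" if "x \<in> I" "y \<in> I"
    using add[of x "- y"] neg[of y] that by simp
  show "r * x \<in> I" if "x \<in> I" "r \<in> carrier R"
    using I_l_closed[OF that] by simp
  show "0 \<in> I"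
    using zero_closed by simp
qed

text \<open>An integer in \<open>P\<close> prime to \<open>p\<close> would, by a Bezout relation
  with \<open>p\<close>, put 1 into \<open>P\<close>.\<close>

lemma of_int_mem_primeideal_iff:
  assumes "primeideal P R" "of_nat p \<in> P" "Factorial_Ring.prime p"
  shows "of_int k \<in> P \<longleftrightarrow> int p dvd k"
proof
  interpret P: primeideal P R by fact
  note closed = ideal_closed[OF P.is_ideal]
  show "of_int k \<in> P" if "int p dvd k"
  proof -
    from that obtain r where "k = int p * r" ..
    then have "(of_int k :: complex) = of_int r * of_nat p"
      by simp
    then show ?thesis
      using closed(4)[OF assms(2) of_int_closed'] by simp
  qed
  show "int p dvd k" if "of_int k \<in> P"
  proof (rule ccontr)
    assume "\<not> int p dvd k"
    then have "coprime (int p) k"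
      using assms(3) by (simp add: prime_imp_coprime)
    then obtain u v where "u * int p + v * k = 1"
      using bezout_int[of "int p" k] by auto
    then have "(of_int u * of_nat p + of_int v * of_int k :: complex) = 1"
      by (metis of_int_1 of_int_add of_int_mult of_int_of_nat_eq)
    then have "1 \<in> P"
      using closed(1)[OF closed(4)[OF assms(2), of "of_int u"] closed(4)[OF that, of "of_int v"]]
        of_int_closed' by simp
    then show False
      using P.one_imp_carrier P.I_notcarr by simp
  qed
qed

text \<open>An integer relation \<open>a + b y + c x = 0\<close> with coefficients not all divisible by \<open>p\<close> is used
  in place of an integral basis. If \<open>p\<close> divided \<open>c\<close>, then \<open>a \<in> P\<close>, so \<open>p\<close> would divide \<open>a\<close> but
  not \<open>b\<close>, and \<open>b y \<in> (p)\<close> would give \<open>y \<in> (p)\<close>. Hence \<open>c\<close> is invertible modulo \<open>p\<close>.\<close>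

lemma congruent_integer:
  assumes "primeideal P R" "of_nat p \<in> P" "Factorial_Ring.prime p"
    and "carrier R \<subseteq> quad_field d" and "y \<in> P" "y \<notin> PIdl (of_nat p)" "x \<in> carrier R"
  obtains k :: int where "x - of_int k \<in> P"
proof -
  interpret P: primeideal P R by fact
  note P_closed = ideal_closed[OF P.is_ideal]
  note p_closed = ideal_closed[OF cgenideal_ideal[OF of_nat_closed'[of p]]]
  have y: "y \<in> carrier R"
    using assms P.Icarr by auto
  have p_mem: "of_nat p \<in> PIdl (of_nat p)"
    using cgenideal_self[OF of_nat_closed'] .
  obtain a b c :: int where rel: "of_int a + of_int b * y + of_int c * x = 0"
    and ndvd: "\<not> (int p dvd a \<and> int p dvd b \<and> int p dvd c)"
  proof (rule quad_field_integer_relation)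
    show "x \<in> quad_field d" "y \<in> quad_field d" "int p > 1"
      using assms y prime_gt_1_nat[OF assms(3)] by auto
  qed
  have inverse: "\<exists>u v. of_int u * of_int k = (1 :: complex) - of_int v * of_nat p"
    if "\<not> int p dvd k" for k
  proof -
    have "coprime (int p) k"
      using assms(3) that by (simp add: prime_imp_coprime)
    then obtain v u where "v * int p + u * k = 1"
      using bezout_int[of "int p" k] by auto
    then have "(of_int v * of_nat p + of_int u * of_int k :: complex) = 1"
      by (metis of_int_1 of_int_add of_int_mult of_int_of_nat_eq)
    then have "of_int u * of_int k = (1 :: complex) - of_int v * of_nat p"
      by (simp add: algebra_simps)
    then show ?thesis
      by blast
  qed
  have "\<not> int p dvd c"
  proof
    assume "int p dvd c"
    then obtain c' where c': "c = int p * c'" ..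
    have cx_p: "of_int c * x \<in> PIdl (of_nat p)"
      using p_closed(4)[OF p_mem, of "of_int c' * x"] assms of_int_closed' mult_closed'
      by (simp add: c' mult_ac)
    have cx_P: "of_int c * x \<in> P"
      using P_closed(4)[OF assms(2), of "of_int c' * x"] assms of_int_closed' mult_closed'
      by (simp add: c' mult_ac)
    have "of_int a = - (of_int b * y + of_int c * x)"
      using rel unfolding eq_neg_iff_add_eq_0 by (simp only: add_ac)
    moreover have "- (of_int b * y + of_int c * x) \<in> P"
      by (intro cx_P P_closed assms of_int_closed')
    ultimately have "of_int a \<in> P"
      by simp
    then have a: "int p dvd a"
      using of_int_mem_primeideal_iff[OF assms(1-3)] by blast
    then obtain a' where a': "a = int p * a'" ..
    have a_p: "of_int a \<in> PIdl (of_nat p)"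
      using p_closed(4)[OF p_mem, of "of_int a'"] of_int_closed' by (simp add: a' mult_ac)
    have "\<not> int p dvd b"
      using a \<open>int p dvd c\<close> ndvd by auto
    then obtain u v where uv: "of_int u * of_int b = (1 :: complex) - of_int v * of_nat p"
      using inverse by blast
    have by_eq: "of_int b * y = - (of_int a + of_int c * x)"
      using rel unfolding eq_neg_iff_add_eq_0 by (simp only: add_ac)
    have by_p: "of_int b * y \<in> PIdl (of_nat p)"
      unfolding by_eq by (intro a_p cx_p p_closed)
    have "of_int u * (of_int b * y) + (of_int v * y) * of_nat p \<in> PIdl (of_nat p)"
      by (intro by_p p_closed p_mem of_int_closed' mult_closed' y)
    also have "of_int u * (of_int b * y) + (of_int v * y) * of_nat p = y"
      using arg_cong[OF uv, of "\<lambda>t. t * y"] by (simp add: algebra_simps)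
    finally show False
      using assms by simp
  qed
  then obtain u v where uv: "of_int u * of_int c = (1 :: complex) - of_int v * of_nat p"
    using inverse by blast
  \<comment> \<open>Multiplying the relation by \<open>u\<close>, the inverse of \<open>c\<close>
    modulo \<open>p\<close>, shows that \<open>x\<close> is congruent to - u a, because
    \<open>y\<close> and \<open>p\<close> lie in \<open>P\<close>.\<close>
  have "x - of_int (- u * a) = (of_int v * x) * of_nat p - (of_int u * of_int b) * y"
  proof -
    have "x - of_int (- u * a) = (of_int v * x) * of_nat p - (of_int u * of_int b) * y
        + (of_int u * (of_int a + of_int b * y + of_int c * x)
        - (of_int u * of_int c - (1 - of_int v * of_nat p)) * x)"
      by (simp add: algebra_simps)
    then show ?thesis
      unfolding rel uv by simp
  qed
  also have "\<dots> \<in> P"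
    by (intro P_closed assms of_int_closed' mult_closed')
  finally show thesis
    by (rule that)
qed

section \<open>Falling products modulo powers of the prime\<close>

lemma congruent_in_block:
  assumes "primeideal P R" "of_nat p \<in> P" "Factorial_Ring.prime p" "x - of_int k \<in> P"
  shows "\<exists>i\<in>{j..<j + p}. x - of_nat i \<in> P"
proof -
  interpret P: primeideal P R by fact
  have "p > 0"
    using assms(3) prime_gt_0_nat by auto
  \<comment> \<open>The offset in the block starting at \<open>j\<close> at which an integer
    congruent to \<open>k\<close> modulo \<open>p\<close> occurs.\<close>
  define t where "t = nat ((k - int j) mod int p)"
  have t: "int t = (k - int j) mod int p"
    using \<open>p > 0\<close> by (simp add: t_def)
  then have "t < p"
    using \<open>p > 0\<close> by (metis of_nat_0_less_iff of_nat_less_iff pos_mod_bound)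
  have "int p dvd k - int j - int t"
    unfolding t by (rule dvd_minus_mod)
  then have "of_int (k - int j - int t) \<in> P"
    using of_int_mem_primeideal_iff[OF assms(1-3)] by blast
  then have "(x - of_int k) + of_int (k - int j - int t) \<in> P"
    by (intro ideal_closed(1)[OF P.is_ideal] assms)
  then have "x - of_nat (j + t) \<in> P"
    by (simp add: algebra_simps)
  then show ?thesis
    using \<open>t < p\<close> by (intro bexI[of _ "j + t"]) auto
qed

lemma falling_product_mem:
  assumes "x \<in> carrier R" "q \<in> carrier R"
    and "\<And>j. \<exists>i\<in>{j..<j + p}. x - of_nat i \<in> PIdl q"
  shows "(\<Prod>i<m. x - of_nat i) \<in> PIdl (q ^ (m div p))"
proof -
  have factor: "x - of_nat i \<in> carrier R" for i
    using assms diff_closed' of_nat_closed' by blast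
  have prod: "(\<Prod>i\<in>S. x - of_nat i) \<in> carrier R" for S
    using factor one_closed by (induction S rule: infinite_finite_induct) (auto simp: mult_closed')
  have block: "(\<Prod>i\<in>{j..<j + p}. x - of_nat i) \<in> PIdl q" for j
  proof -
    obtain i r where i: "i \<in> {j..<j + p}" and r: "r \<in> carrier R" "x - of_nat i = r * q"
      using assms(3) mem_PIdl_iff by metis
    have "(\<Prod>i\<in>{j..<j + p}. x - of_nat i) = (x - of_nat i) * (\<Prod>i\<in>{j..<j + p} - {i}. x - of_nat i)"
      using i by (intro prod.remove) auto
    then show ?thesis
      using r prod mult_closed' unfolding mem_PIdl_iff
      by (intro bexI[of _ "r * (\<Prod>i\<in>{j..<j + p} - {i}. x - of_nat i)"]) auto
  qed
  have blocks: "(\<Prod>i<k * p. x - of_nat i) \<in> PIdl (q ^ k)" for k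
  proof (induction k)
    case 0
    then show ?case
      using one_closed by (auto simp: mem_PIdl_iff)
  next
    case (Suc k)
    have "(\<Prod>i<Suc k * p. x - of_nat i)
        = (\<Prod>i<k * p. x - of_nat i) * (\<Prod>i\<in>{k * p..<k * p + p}. x - of_nat i)"
      by (subst prod.union_disjoint[symmetric])
         (auto simp: add.commute ivl_disj_un_one(2) intro!: prod.cong)
    moreover obtain r where r: "r \<in> carrier R" "(\<Prod>i<k * p. x - of_nat i) = r * q ^ k"
      using Suc mem_PIdl_iff by auto
    moreover obtain t where "t \<in> carrier R" "(\<Prod>i\<in>{k * p..<k * p + p}. x - of_nat i) = t * q"
      using block mem_PIdl_iff by metis
    ultimately show ?case
      unfolding mem_PIdl_iff by (intro bexI[of _ "r * t"]) (auto simp: mult_closed')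
  qed
  \<comment> \<open>The m mod p factors after the last full block only need to lie in the ring,
    since the ideal absorbs them.\<close>
  have "(\<Prod>i<m. x - of_nat i)
      = (\<Prod>i\<in>{m div p * p..<m}. x - of_nat i) * (\<Prod>i<m div p * p. x - of_nat i)"
    by (subst prod.union_disjoint[symmetric])
       (auto intro!: prod.cong intro: order.strict_trans2[OF _ div_times_less_eq_dividend])
  then show ?thesis
    using ideal_closed(4)[OF cgenideal_ideal blocks prod] assms(2) nat_pow_closed[of q "m div p"]
    by simp
qed

section \<open>Divisibility of the constants and of their gcd\<close>

lemma pte_const_carrier:
  assumes "ideal_pte_solution (carrier R) m X Y"
  shows "pte_const X Y \<in> carrier R"
proof -
  have "set_mset X \<subseteq> carrier R" "set_mset Y \<subseteq> carrier R"
    using assms unfolding ideal_pte_solution_def pte_solution_def by auto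
  then show ?thesis
    unfolding pte_const_eq_prod_diff[OF assms]
    by (intro diff_closed' prod_mset_closed' uminus_closed') auto
qed

lemma size_mult_pte_const_mem:
  assumes "ideal_pte_solution (carrier R) m X Y" "q \<in> carrier R"
    and "\<And>x j. x \<in> carrier R \<Longrightarrow> \<exists>i\<in>{j..<j + p}. x - of_nat i \<in> PIdl q"
  shows "of_nat m * pte_const X Y \<in> PIdl (q ^ (m div p))"
proof -
  \<comment> \<open>The falling factorial, written as a \<open>root_poly\<close> so that its degree
    and leading coefficient are already known.\<close>
  define f :: "complex poly" where "f = root_poly (image_mset of_nat (mset_set {..<m}))"
  have f: "degree f = m" "coeff f m = 1"
    using degree_root_poly[of "image_mset of_nat (mset_set {..<m})"]
      lead_coeff_root_poly[of "image_mset of_nat (mset_set {..<m})"]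
    by (simp_all add: f_def)
  have poly_f: "poly f x = (\<Prod>i<m. x - of_nat i)" for x
    unfolding f_def poly_root_poly by (simp add: image_mset.compositionality o_def prod_unfold_prod_mset)
  have sub: "set_mset X \<subseteq> carrier R" "set_mset Y \<subseteq> carrier R"
    using assms unfolding ideal_pte_solution_def pte_solution_def by auto
  have "ideal (PIdl (q ^ (m div p))) R"
    using assms(2) nat_pow_closed[of q "m div p"] by (intro cgenideal_ideal) simp
  note closed = ideal_closed[OF this]
  have "(\<Sum>z\<in>#Z. poly f z) \<in> PIdl (q ^ (m div p))" if "set_mset Z \<subseteq> carrier R" for Z
    using that falling_product_mem[OF _ assms(2,3)] closed
    by (induction Z) (auto simp: poly_f)
  then show ?thesis
    unfolding size_mult_pte_const[OF assms(1) f] using closed(2) sub by blast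
qed

text \<open>Write m = u q^l with \<open>u\<close> not divisible by \<open>q\<close>. For each
  constant \<open>c\<close>, cancelling q^l from the divisibility of m c leaves q^t dividing u c,
  hence \<open>c\<close>. So q^t is a common divisor of all constants and divides their gcd.\<close>

lemma pte_constant_mem:
  assumes "is_pte_constant R m C" "q \<in> carrier R" "ring_prime q"
    and "\<And>x j. x \<in> carrier R \<Longrightarrow> \<exists>i\<in>{j..<j + p}. x - of_nat i \<in> PIdl q"
    and "of_nat m \<in> PIdl (q ^ l)" "of_nat m \<notin> PIdl (q ^ Suc l)" and "m div p = l + t"
  shows "C \<in> PIdl (q ^ t)"
proof -
  have pow_carr: "q ^ k \<in> carrier R" for k
    using assms(2) nat_pow_closed[of q k] by simp
  have "q \<noteq> 0"
    using assms(3) unfolding ring_prime_def by simp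
  obtain u where u: "u \<in> carrier R" "of_nat m = u * q ^ l"
    using assms(5) mem_PIdl_iff by auto
  have "\<not> q divides u"
  proof
    assume "q divides u"
    then obtain r where "r \<in> carrier R" "u = r * q"
      using mem_PIdl_iff mem_PIdl_iff_divides by metis
    then have "of_nat m \<in> PIdl (q ^ Suc l)"
      using u(2) by (auto simp: mem_PIdl_iff mult.assoc)
    then show False
      using assms(6) by blast
  qed
  have "(q ^ t) divides c" if c: "ideal_pte_solution (carrier R) m X Y" "c = pte_const X Y" for X Y c
  proof -
    obtain r where r: "r \<in> carrier R" "of_nat m * c = r * q ^ (l + t)"
      using size_mult_pte_const_mem[OF c(1) assms(2,4)] assms(7) c(2) mem_PIdl_iff by metis
    have "q ^ l * (u * c) = q ^ l * (r * q ^ t)"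
      using r(2) by (simp add: u(2) power_add mult_ac)
    then have "u * c = r * q ^ t"
      using \<open>q \<noteq> 0\<close> by simp
    then have "(q ^ t) divides (u * c)"
      using r(1) mem_PIdl_iff mem_PIdl_iff_divides by metis
    then show ?thesis
      using ring_prime_pow_divides_mult[of q u c t] assms(2,3) u(1) \<open>\<not> q divides u\<close>
        pte_const_carrier[OF c(1)] c(2) by simp
  qed
  then have "(q ^ t) divides C"
    using assms(1) pow_carr unfolding is_pte_constant_def is_gcd_of_set_def by blast
  then show ?thesis
    by (simp add: mem_PIdl_iff_divides)
qed

end

theorem theorem5p4:
  fixes d :: int and n p s l :: nat and P :: "complex set" and C :: complex
  defines "R \<equiv> quad_ring d"
  assumes "squarefree d" and "d \<noteq> 1"
    and "factorial_domain R"
    and "n \<ge> 1"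
    and "is_pte_constant R (n + 1) C"
    and "Factorial_Ring.prime p"
    and "ramified_with R p P \<or> (\<exists>P1 P2. split_with R p P1 P2 \<and> (P = P1 \<or> P = P2))"
    and "s = (n + 1) div p"
    and "of_nat (n + 1) \<in> ideal_power R P l"
    and "\<forall>j. of_nat (n + 1) \<in> ideal_power R P j \<longrightarrow> j \<le> l"
  shows "C \<in> ideal_power R P (nat (max (int s - int l) 0))"
proof -
  interpret factorial_domain R by fact
  interpret complex_factorial_domain R
    by unfold_locales (auto simp: R_def quad_ring_def)
  have sub: "carrier R \<subseteq> quad_field d"
    by (auto simp: R_def quad_ring_def)
  have p: "of_nat p \<in> carrier R" "of_nat p \<noteq> \<zero>\<^bsub>R\<^esub>"
    using of_nat_closed' assms(7) by auto
  \<comment> \<open>\<open>Q\<close> is \<open>P\<close> itself in the ramified case and the other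
    prime factor in the split case, which treats both cases at once.\<close>
  obtain Q where PQ: "primeideal P R" "primeideal Q R" "P \<cdot>\<^bsub>R\<^esub> Q = PIdl\<^bsub>R\<^esub> (of_nat p)"
    using assms(8) ideal_prod_commute unfolding ramified_with_def split_with_def
    by (metis primeideal.axioms(1))
  interpret P: primeideal P R by fact
  interpret Q: primeideal Q R by fact
  have p_P: "of_nat p \<in> P"
    using ideal_prod_inter[OF P.is_ideal Q.is_ideal] cgenideal_self[OF p(1)] PQ(3) by auto
  obtain q where q: "q \<in> carrier R" "P = PIdl\<^bsub>R\<^esub> q"
    using primeideal_factor_principal[OF PQ p] .
  obtain r where "of_nat p = r * q"
    using p_P mem_PIdl_iff unfolding q(2) by blast
  then have "q \<noteq> \<zero>\<^bsub>R\<^esub>"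
    using p(2) by auto
  then have q_prime: "ring_prime\<^bsub>R\<^esub> q"
    using primeideal_iff_prime[of q] q(1) PQ(1)[unfolded q(2)] by blast
  obtain y where y: "y \<in> P" "y \<notin> PIdl\<^bsub>R\<^esub> (of_nat p)"
    using primeideal_factor_not_subset[OF P.is_ideal PQ(2,3) p q(2,1)] by blast
  have block: "\<exists>i\<in>{j..<j + p}. x - of_nat i \<in> PIdl\<^bsub>R\<^esub> q" if x: "x \<in> carrier R" for x j
  proof -
    obtain k :: int where "x - of_int k \<in> P"
      using congruent_integer[OF PQ(1) p_P assms(7) sub y x] .
    then show ?thesis
      using congruent_in_block[OF PQ(1) p_P assms(7)] unfolding q(2) by blast
  qed
  have power: "ideal_power R P k = PIdl\<^bsub>R\<^esub> (q ^ k)" for k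
    using ideal_power_PIdl[OF q(1)] unfolding q(2) nat_pow_eq .
  show ?thesis
  proof (cases "s \<le> l")
    case True
    \<comment> \<open>The exponent is truncated to 0, and the zeroth power is the whole
      ring.\<close>
    then have "nat (max (int s - int l) 0) = 0"
      by simp
    then show ?thesis
      using assms(6) unfolding is_pte_constant_def is_gcd_of_set_def
      by (simp add: ideals_set_def nat_pow_def)
  next
    case False
    then obtain t where t: "s = l + t"
      by (metis le_add_diff_inverse nat_le_linear)
    \<comment> \<open>Maximality of \<open>l\<close> makes it the exact multiplicity of
      \<open>q\<close> in n + 1.\<close>
    have "of_nat (n + 1) \<notin> PIdl\<^bsub>R\<^esub> (q ^ Suc l)"
      using assms(11) power Suc_n_not_le_n by metis
    moreover have "of_nat (n + 1) \<in> PIdl\<^bsub>R\<^esub> (q ^ l)" "(n + 1) div p = l + t"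
      using assms(9,10) power t by simp_all
    ultimately have "C \<in> PIdl\<^bsub>R\<^esub> (q ^ t)"
      using pte_constant_mem[OF assms(6) q(1) q_prime block] by blast
    moreover have "nat (max (int s - int l) 0) = t"
      using t by simp
    ultimately show ?thesis
      using power by simp
  qed
qed

end
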